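(* Let $X\subset\mathcal M^B$ be bounded. There exist $\beta_g>0$ and $\beta_H>0$ such that for every $x\in X$ and all $v,u\in T_x\mathcal M^B$ with $\|v\|_x=\|u\|_x=1$, $$\|\operatorname{grad}J^B(x)\|_{\mathcal E}\le\beta_g\qquad\text{and}\qquad\bigl|\bigl(\operatorname{Hess}J_x^B(0)[v],u\bigr)_{\mathcal E}\bigr|\le\beta_H .$$
   Context: $\mathcal E,\mathcal Y$ are real Hilbert spaces. $\mathcal M\subset\mathcal E$ is a $C^2$ embedded submanifold; for $x\in\mathcal M$ the tangent space $T_x\mathcal M$ is identified with a closed linear subspace of $\mathcal E$. $B:\mathcal E\to\mathcal Y$ is a surjective bounded linear operator with adjoint $B^*$, $c\in\mathcal Y$, and $\mathcal M^B:=\{x\in\mathcal M: Bx=c\}$ is nonempty. For each $x\in\mathcal M$ a bounded linear projection $P_x:\mathcal E\to T_x\mathcal M$ onto $T_x\mathcal M$ is given (not necessarily orthogonal), and $L_x:=BP_xB^*:\mathcal Y\to\mathcal Y$. For each $x\in\mathcal M$ a $C^2$ map $R_x:T_x\mathcal M\to\mathcal M$ is given with $R_x(0)=x$, $DR_x(0)=\mathrm{Id}$; the symmetric bilinear map $\ell_x:T_x\mathcal M\times T_x\mathcal M\to\mathcal E$ with $\frac{d^2}{d\alpha^2}R_x(\alpha v)|_{\alpha=0}=\ell_x(v,v)$ satisfies $\sup_{x\in S}\|\ell_x\|<\infty$ for every bounded $S\subset\mathcal M$. Standing assumptions: (A1) for every bounded $S\subset\mathcal M^B$ there is $C_S>0$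 with $(L_x\delta,\delta)_{\mathcal Y}\ge C_S\|\delta\|_{\mathcal Y}^2$ for all $x\in S$, $\delta\in\mathcal Y$; (A2) the map $\mathcal M\to\mathcal L(\mathcal E,\mathcal E)$, $x\mapsto P_x$, is continuous and maps bounded sets to bounded sets; (A3) for every bounded $S\subset\mathcal M$ there are $\sigma,K_1,K_2>0$ such that $\|DR_x(u)\|\le K_1$ and $\|D^2R_x(u)\|\le K_2$ for all $x\in S$ and $u\in T_x\mathcal M$ with $\|u\|_{\mathcal E}\le\sigma$. Under (A1), $L_x$ is invertible and $\mathcal M^B$ is a $C^2$ Hilbert submanifold with $T_x\mathcal M^B=T_x\mathcal M\cap\ker B$, endowed with the ambient metric $(u,v)_x=(u,v)_{\mathcal E}$, norm $\|\cdot\|_x$. Implicit retraction: for each $x\in X$, there is a $C^2$ map $\delta_x$ from a neighborhood of $0$ in $T_x\mathcal M^B$ to $\mathcal Y$ with $\delta_x(0)=0$ and $BR_x(v-P_xB^*\delta_x(v))=c$; put $R_x^B(v):=R_x(v-P_xB^*\delta_x(v))\in\mathcal M^B$. Objective: $J:\mathcal E\to\mathbb R$ is $C^2$, bounded from below and coercive; its gradient $\operatorname{grad}J:\mathcal E\to\mathcal E$ and Hessian $\operatorname{Hess}J:\mathcal E\to\mathcal L(\mathcal E;\mathcal E)$ map bounded sets to bounded sets. $J^B:=J|_{\mathcal M^B}$; $\operatorname{grad}J^B(x)\in T_x\mathcal M^B$ is its Riemannian gradient for $(\cdot,\cdot)_x$. The lifted objective is $J_x^B(\xi):=J^B(R_x^B(\xi))$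 near $0$, and $\operatorname{Hess}J_x^B(0):T_x\mathcal M^B\to T_x\mathcal M^B$ is its Hessian at $0$ with respect to $(\cdot,\cdot)_x$. *)

theory Defs
  imports "HOL-Analysis.Analysis"
begin

text \<open>
  Real Hilbert spaces are rendered as types of sort \<open>{real_inner, complete_space}\<close>.

  \<open>C2_derivs S f D D2\<close>: the map \<open>f\<close> is of class C2 on \<open>S\<close>, with first and second
  derivatives \<open>D\<close> and \<open>D2\<close>. It is used for \<open>S\<close> open, and for \<open>S\<close> relatively open in a
  closed linear subspace \<open>T\<close>. In the second case \<open>D x\<close> and \<open>D2 x\<close> are extensions to the whole
  space of the derivatives of \<open>f\<close> as a map on \<open>T\<close>; only their values at arguments in \<open>T\<close> are
  determined by \<open>f\<close>. Composing with the orthogonal projection onto \<open>T\<close> shows that such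
  extensions exist whenever \<open>f\<close> is C2 as a map on \<open>T\<close>.
\<close>

definition C2_derivs ::
  "'a::real_normed_vector set \<Rightarrow> ('a \<Rightarrow> 'b::real_normed_vector)
    \<Rightarrow> ('a \<Rightarrow> 'a \<Rightarrow>\<^sub>L 'b) \<Rightarrow> ('a \<Rightarrow> 'a \<Rightarrow>\<^sub>L 'a \<Rightarrow>\<^sub>L 'b) \<Rightarrow> bool" where
  "C2_derivs S f D D2 \<longleftrightarrow>
     (\<forall>x\<in>S. (f has_derivative blinfun_apply (D x)) (at x within S)) \<and>
     (\<forall>x\<in>S. (D has_derivative blinfun_apply (D2 x)) (at x within S)) \<and>
     continuous_on S D2"

definition C2_on ::
  "'a::real_normed_vector set \<Rightarrow> ('a \<Rightarrow> 'b::real_normed_vector) \<Rightarrow> bool" where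
  "C2_on S f \<longleftrightarrow> (\<exists>D D2. C2_derivs S f D D2)"

text \<open>Slice charts. A closed subspace of a Hilbert space is automatically complemented, so no
  splitting condition is needed.\<close>

definition C2_submanifold :: "'a::{real_inner,complete_space} set \<Rightarrow> bool" where
  "C2_submanifold M \<longleftrightarrow>
     (\<forall>x\<in>M. \<exists>U V F. \<exists>(\<phi> :: 'a \<Rightarrow> 'a) (\<psi> :: 'a \<Rightarrow> 'a).
        open U \<and> x \<in> U \<and> open V \<and> subspace F \<and> closed F \<and>
        homeomorphism U V \<phi> \<psi> \<and> C2_on U \<phi> \<and> C2_on V \<psi> \<and>
        \<phi> ` (M \<inter> U) = V \<inter> F)"

definition curve_in ::
  "'a::real_normed_vector set \<Rightarrow> 'a \<Rightarrow> 'a \<Rightarrow> (real \<Rightarrow> 'a) \<Rightarrow> bool" where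
  "curve_in N x v \<gamma> \<longleftrightarrow>
     \<gamma> 0 = x \<and> (\<forall>\<^sub>F t in nhds 0. \<gamma> t \<in> N) \<and> (\<gamma> has_vector_derivative v) (at 0)"

definition tangent_space :: "'a::real_normed_vector set \<Rightarrow> 'a \<Rightarrow> 'a set" where
  "tangent_space N x = {v. \<exists>\<gamma>. curve_in N x v \<gamma>}"

text \<open>The gradient at \<open>x\<close> of the restriction of \<open>f\<close> to \<open>N\<close>, for the metric on \<open>N\<close> induced by
  the ambient inner product.\<close>

definition riemannian_grad ::
  "'a::real_inner set \<Rightarrow> ('a \<Rightarrow> real) \<Rightarrow> 'a \<Rightarrow> 'a" where
  "riemannian_grad N f x =
     (THE g. g \<in> tangent_space N x \<and>
        (\<forall>v \<gamma>. curve_in N x v \<gamma> \<longrightarrow>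
           ((\<lambda>t. f (\<gamma> t)) has_real_derivative g \<bullet> v) (at 0)))"

text \<open>Gradient and Hessian of \<open>f\<close> at \<open>u\<close> as a function on the Hilbert space \<open>T\<close>, a closed linear
  subspace of the ambient space; \<open>f\<close> only matters on a neighbourhood of \<open>u\<close> in \<open>T\<close>. The Hessian
  is the derivative of the gradient, and is meaningful at arguments in \<open>T\<close> only.\<close>

definition grad_on :: "'a::real_inner set \<Rightarrow> ('a \<Rightarrow> real) \<Rightarrow> 'a \<Rightarrow> 'a" where
  "grad_on T f u = (THE g. g \<in> T \<and> (f has_derivative (\<lambda>v. g \<bullet> v)) (at u within T))"

definition hess_on :: "'a::real_inner set \<Rightarrow> ('a \<Rightarrow> real) \<Rightarrow> 'a \<Rightarrow> 'a \<Rightarrow> 'a" where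
  "hess_on T f u = frechet_derivative (grad_on T f) (at u within T)"

definition sym_bilinear_on :: "'a::real_vector set \<Rightarrow> ('a \<Rightarrow> 'a \<Rightarrow> 'b::real_vector) \<Rightarrow> bool" where
  "sym_bilinear_on T b \<longleftrightarrow>
     (\<forall>v\<in>T. \<forall>w\<in>T. b v w = b w v) \<and>
     (\<forall>u\<in>T. \<forall>v\<in>T. \<forall>w\<in>T. b (u + v) w = b u w + b v w) \<and>
     (\<forall>v\<in>T. \<forall>w\<in>T. \<forall>a. b (a *\<^sub>R v) w = a *\<^sub>R b v w)"

definition constrained :: "'e::real_normed_vector set \<Rightarrow> ('e \<Rightarrow>\<^sub>L 'y::real_normed_vector) \<Rightarrow> 'y \<Rightarrow> 'e set"
  where "constrained M B c = {x \<in> M. blinfun_apply B x = c}"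

definition L_op ::
  "('e::real_inner \<Rightarrow>\<^sub>L 'y::real_inner) \<Rightarrow> ('e \<Rightarrow> 'e \<Rightarrow>\<^sub>L 'e) \<Rightarrow> 'e \<Rightarrow> 'y \<Rightarrow> 'y" where
  "L_op B P x d = blinfun_apply B (blinfun_apply (P x) (adjoint (blinfun_apply B) d))"

definition implicit_retraction ::
  "('e::real_inner \<Rightarrow>\<^sub>L 'y::real_inner) \<Rightarrow> ('e \<Rightarrow> 'e \<Rightarrow>\<^sub>L 'e) \<Rightarrow> ('e \<Rightarrow> 'e \<Rightarrow> 'e)
    \<Rightarrow> ('e \<Rightarrow> 'e \<Rightarrow> 'y) \<Rightarrow> 'e \<Rightarrow> 'e \<Rightarrow> 'e" where
  "implicit_retraction B P R \<delta> x v =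
     R x (v - blinfun_apply (P x) (adjoint (blinfun_apply B) (\<delta> x v)))"

definition lifted_objective ::
  "('e::real_inner \<Rightarrow>\<^sub>L 'y::real_inner) \<Rightarrow> ('e \<Rightarrow> 'e \<Rightarrow>\<^sub>L 'e) \<Rightarrow> ('e \<Rightarrow> 'e \<Rightarrow> 'e)
    \<Rightarrow> ('e \<Rightarrow> 'e \<Rightarrow> 'y) \<Rightarrow> ('e \<Rightarrow> real) \<Rightarrow> 'e \<Rightarrow> 'e \<Rightarrow> real" where
  "lifted_objective B P R \<delta> J x \<xi> = J (implicit_retraction B P R \<delta> x \<xi>)"

end

theory Submission
  imports Defs
begin

text \<open>
  Write \<open>T\<close> for the tangent space of \<open>M\<close> at \<open>x \<in> X\<close>, \<open>Q = P\<^sub>x B\<^sup>*\<close> and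
  \<open>w(\<xi>) = \<xi> - Q \<delta>\<^sub>x(\<xi>)\<close>, so that the implicit retraction is \<open>\<rho> = R\<^sub>x \<circ> w\<close>.

  The Riemannian gradient is the orthogonal projection of \<open>gradJ x\<close> onto the tangent space of the
  constrained set, and is therefore no longer than \<open>gradJ x\<close>, which is bounded on \<open>X\<close>.

  For the Hessian the point is that the correction term \<open>\<delta>\<^sub>x\<close>, although no bound on its
  derivatives is assumed, is controlled at \<open>0\<close> by the constraint. Differentiating
  \<open>B R\<^sub>x(w(\<xi>)) = c\<close> once at \<open>0\<close> along tangent directions gives \<open>L\<^sub>x D\<delta>\<^sub>x(0)v = B v = 0\<close>, so
  \<open>D\<delta>\<^sub>x(0) = 0\<close> and \<open>D\<rho>(0) = id\<close> in these directions. Differentiating twice gives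
  \<open>L\<^sub>x D\<^sup>2\<delta>\<^sub>x(0)[v,u] = B D\<^sup>2R\<^sub>x(0)[v,u]\<close>, and coercivity of \<open>L\<^sub>x\<close>, uniform on \<open>X\<close>, bounds
  \<open>D\<^sup>2\<delta>\<^sub>x(0)\<close> and hence \<open>D\<^sup>2\<rho>(0)\<close> (\<open>implicit_retraction_second_order\<close>). The chain rule
  (\<open>hess_on_comp_inner_eq\<close>) then yields
  \<open>(Hess v, u) = (gradJ x, D\<^sup>2\<rho>(0)[v,u]) + (HessJ x v, u)\<close>,
  in which every factor is bounded on \<open>X\<close>.

  These arguments use gradients and Hessians on the tangent space of the constrained set, which exist
  and are unique only because that space is a closed linear subspace. It is in fact
  \<open>T \<inter> ker B\<close>. The inclusion needing work is that every \<open>v\<close> in \<open>T \<inter> ker B\<close> is the velocity of a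
  curve in the constrained set (\<open>kernel_subset_tangent_space_constrained\<close>): one
  corrects \<open>R\<^sub>x(t v)\<close> by solving \<open>B R\<^sub>x(t v - Q d) = c\<close> for \<open>d\<close>. Up to sign and a small error,
  the increments of the left side in \<open>d\<close> are those of the coercive operator \<open>L\<^sub>x\<close>. So the equation is
  strongly monotone near \<open>0\<close>, and Banach's fixed point theorem gives a solution of size \<open>o(t)\<close>.
\<close>

section \<open>Riesz representation and adjoints in Hilbert space\<close>

lemma orthogonal_to_subspace_eq:
  fixes g h :: "'a::real_inner"
  assumes "subspace T" "g \<in> T" "h \<in> T" and eq: "\<And>v. v \<in> T \<Longrightarrow> g \<bullet> v = h \<bullet> v"
  shows "g = h"
proof -
  have "g - h \<in> T"
    using assms(1-3) by (rule subspace_diff)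
  from eq[OF this] have "(g - h) \<bullet> (g - h) = 0"
    by (simp add: inner_diff_left)
  then show ?thesis by simp
qed

text \<open>The representing vector minimises \<open>\<parallel>v\<parallel>\<^sup>2 - 2 f v\<close> over \<open>T\<close>. The parallelogram law makes a
  minimising sequence Cauchy, and the first-order condition at the minimiser is
  \<open>g \<bullet> v = f v\<close>.\<close>

lemma riesz_representation_on:
  fixes T :: "'a::{real_inner,complete_space} set" and f :: "'a \<Rightarrow>\<^sub>L real"
  assumes T: "subspace T" and cl: "closed T"
  obtains g where "g \<in> T" "\<And>v. v \<in> T \<Longrightarrow> f v = g \<bullet> v"
proof -
  define q where "q v = (norm v)\<^sup>2 - 2 * f v" for v
  have q_lower: "- (norm f)\<^sup>2 \<le> q v" for v
  proof -
    have "f v \<le> norm f * norm v"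
      using norm_blinfun[of f v] by simp
    moreover have "0 \<le> (norm v - norm f)\<^sup>2" by simp
    ultimately show ?thesis
      unfolding q_def by (simp add: power2_diff algebra_simps)
  qed
  define m where "m = Inf (q ` T)"
  have ne: "q ` T \<noteq> {}" using subspace_0[OF T] by auto
  have bdd: "bdd_below (q ` T)"
    using q_lower by (auto intro!: bdd_belowI)
  have m_le: "m \<le> q v" if "v \<in> T" for v
    unfolding m_def using that bdd by (auto intro: cInf_lower)
  define u where "u n = inverse (real (Suc n))" for n
  have "\<exists>v\<in>T. q v < m + u n" for n
  proof -
    have "Inf (q ` T) < m + u n"
      unfolding m_def u_def by simp
    from cInf_lessD[OF ne this] show ?thesis by auto
  qed
  then obtain s where sT: "\<And>n. s n \<in> T" and s_lt: "\<And>n. q (s n) < m + u n"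
    by metis
  have par: "(norm (a - b))\<^sup>2 \<le> 2 * (q a - m) + 2 * (q b - m)" if "a \<in> T" "b \<in> T" for a b
  proof -
    have mid: "(1/2) *\<^sub>R (a + b) \<in> T"
      using T that by (simp add: subspace_add subspace_scale)
    have "(norm (a - b))\<^sup>2 = 2 * q a + 2 * q b - 4 * q ((1/2) *\<^sub>R (a + b))"
      unfolding q_def power2_norm_eq_inner blinfun.bilinear_simps
      by (simp add: inner_simps inner_commute algebra_simps)
    with m_le[OF mid] show ?thesis by simp
  qed
  have "Cauchy s"
  proof (rule metric_CauchyI)
    fix e :: real assume e: "0 < e"
    obtain N where N: "u N < e\<^sup>2 / 4"
      unfolding u_def using reals_Archimedean[of "e\<^sup>2 / 4"] e by auto
    show "\<exists>M. \<forall>m\<ge>M. \<forall>n\<ge>M. dist (s m) (s n) < e"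
    proof (intro exI allI impI)
      fix i j assume "N \<le> i" "N \<le> j"
      then have "u i \<le> u N" "u j \<le> u N"
        unfolding u_def by (auto intro!: le_imp_inverse_le)
      with par[OF sT sT, of i j] s_lt[of i] s_lt[of j] N
      have "(norm (s i - s j))\<^sup>2 < e\<^sup>2" by argo
      then show "dist (s i) (s j) < e"
        using e by (simp add: dist_norm power_less_imp_less_base)
    qed
  qed
  then obtain g where g: "s \<longlonglongrightarrow> g"
    using Cauchy_convergent_iff convergent_def by blast
  have gT: "g \<in> T"
    using closed_sequentially[OF cl] sT g by blast
  have "(\<lambda>n. q (s n)) \<longlonglongrightarrow> q g"
    unfolding q_def by (intro tendsto_intros g)
  moreover have "(\<lambda>n. m + u n) \<longlonglongrightarrow> m + 0"
    unfolding u_def by (intro tendsto_add tendsto_const LIMSEQ_inverse_real_of_nat)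
  ultimately have qg: "q g \<le> m"
    using s_lt by (auto intro: LIMSEQ_le less_imp_le)
  have "f v = g \<bullet> v" if v: "v \<in> T" for v
  proof -
    have "0 \<le> (norm v)\<^sup>2 * t\<^sup>2 + 2 * (g \<bullet> v - f v) * t" for t
    proof -
      have "g + t *\<^sub>R v \<in> T"
        using T gT v by (simp add: subspace_add subspace_scale)
      from m_le[OF this] qg have "q g \<le> q (g + t *\<^sub>R v)" by simp
      then show ?thesis
        unfolding q_def power2_norm_eq_inner blinfun.bilinear_simps
        by (simp add: inner_simps inner_commute algebra_simps power2_eq_square)
    qed
    note quad = this
    define a where "a = g \<bullet> v - f v"
    define b where "b = (norm v)\<^sup>2"
    have b: "0 \<le> b" unfolding b_def by simp
    \<comment> \<open>At \<open>t = - a k\<close> the quadratic is at most \<open>- a\<^sup>2 k\<close>; the summand 1 covers \<open>v = 0\<close>.\<close>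
    define k where "k = 1 / (b + 1)"
    have k: "0 < k" and bk: "b * k \<le> 1" unfolding k_def using b by auto
    have "0 \<le> b * (- a * k)\<^sup>2 + 2 * a * (- a * k)"
      using quad[of "- a * k"] unfolding a_def b_def .
    also have "\<dots> = (a\<^sup>2 * k) * (b * k) - 2 * (a\<^sup>2 * k)"
      by (simp add: power2_eq_square algebra_simps)
    also have "\<dots> \<le> (a\<^sup>2 * k) * 1 - 2 * (a\<^sup>2 * k)"
      using bk k by (intro diff_right_mono mult_left_mono) auto
    finally have "a\<^sup>2 * k \<le> 0" by argo
    then have "a = 0" using k by (simp add: mult_le_0_iff)
    then show ?thesis unfolding a_def by simp
  qed
  with gT that show thesis by blast
qed

text \<open>For a closed subspace \<open>T\<close> and \<open>f v = a \<bullet> v\<close> this is the orthogonal projection of \<open>a\<close> onto \<open>T\<close>.\<close>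

definition riesz_rep :: "'a::{real_inner,complete_space} set \<Rightarrow> ('a \<Rightarrow>\<^sub>L real) \<Rightarrow> 'a" where
  "riesz_rep T f = (SOME g. g \<in> T \<and> (\<forall>v\<in>T. f v = g \<bullet> v))"

context
  fixes T :: "'a::{real_inner,complete_space} set"
  assumes T: "subspace T" "closed T"
begin

lemma riesz_rep_in: "riesz_rep T f \<in> T"
  and riesz_rep_inner: "v \<in> T \<Longrightarrow> riesz_rep T f \<bullet> v = f v"
proof -
  have "\<exists>g. g \<in> T \<and> (\<forall>v\<in>T. f v = g \<bullet> v)"
    by (rule riesz_representation_on[OF T, of f]) blast
  from someI_ex[OF this] show "riesz_rep T f \<in> T" "v \<in> T \<Longrightarrow> riesz_rep T f \<bullet> v = f v"
    unfolding riesz_rep_def by auto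
qed

lemma riesz_rep_unique: "g \<in> T \<Longrightarrow> (\<And>v. v \<in> T \<Longrightarrow> blinfun_apply f v = g \<bullet> v) \<Longrightarrow> riesz_rep T f = g" for f :: "'a \<Rightarrow>\<^sub>L real"
  by (rule orthogonal_to_subspace_eq[OF T(1) riesz_rep_in]) (auto simp: riesz_rep_inner)

lemma norm_riesz_rep_le: "norm (riesz_rep T f) \<le> norm f"
proof -
  have "(norm (riesz_rep T f))\<^sup>2 = f (riesz_rep T f)"
    by (simp add: power2_norm_eq_inner riesz_rep_inner riesz_rep_in)
  also have "\<dots> \<le> norm f * norm (riesz_rep T f)"
    using norm_blinfun[of f "riesz_rep T f"] by simp
  finally show ?thesis
    by (cases "riesz_rep T f = 0") (auto simp: power2_eq_square)
qed

lemma bounded_linear_riesz_rep: "bounded_linear (riesz_rep T)"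
proof (rule bounded_linear_intro[where K = 1])
  show "riesz_rep T (f + g) = riesz_rep T f + riesz_rep T g" for f g
    using T(1) by (intro riesz_rep_unique)
      (auto simp: subspace_add riesz_rep_in riesz_rep_inner blinfun.bilinear_simps inner_simps)
  show "riesz_rep T (r *\<^sub>R f) = r *\<^sub>R riesz_rep T f" for r f
    using T(1) by (intro riesz_rep_unique)
      (auto simp: subspace_scale riesz_rep_in riesz_rep_inner blinfun.bilinear_simps inner_simps)
qed (simp add: norm_riesz_rep_le)

end

text \<open>The constant \<open>adjoint\<close> is a choice among the maps with this property, so what has to be
  shown is that one exists; Riesz representation supplies it.\<close>

lemma adjoint_blinfun_inner:
  fixes B :: "'a::{real_inner,complete_space} \<Rightarrow>\<^sub>L 'b::real_inner"
  shows "B x \<bullet> y = x \<bullet> adjoint (blinfun_apply B) y"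
proof -
  have "\<forall>y. \<exists>g. \<forall>x. B x \<bullet> y = x \<bullet> g"
  proof
    fix y
    obtain g where "\<And>v. v \<in> UNIV \<Longrightarrow> (blinfun_inner_left y o\<^sub>L B) v = g \<bullet> v"
      by (rule riesz_representation_on[OF subspace_UNIV closed_UNIV]) blast
    then show "\<exists>g. \<forall>x. B x \<bullet> y = x \<bullet> g"
      by (auto simp: inner_commute)
  qed
  then obtain f where "\<forall>y x. B x \<bullet> y = x \<bullet> f y" by metis
  then have "\<exists>f'. \<forall>x y. B x \<bullet> y = x \<bullet> f' y" by blast
  from someI_ex[OF this] show ?thesis unfolding adjoint_def by blast
qed

lemma bounded_linear_adjoint_blinfun:
  fixes B :: "'a::{real_inner,complete_space} \<Rightarrow>\<^sub>L 'b::real_inner"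
  shows "bounded_linear (adjoint (blinfun_apply B))"
    and norm_adjoint_blinfun_le: "norm (adjoint (blinfun_apply B) y) \<le> norm B * norm y"
proof -
  let ?A = "adjoint (blinfun_apply B)"
  note adj = adjoint_blinfun_inner[of B, symmetric]
  show bound: "norm (?A y) \<le> norm B * norm y" for y
  proof -
    have "(norm (?A y))\<^sup>2 = B (?A y) \<bullet> y"
      by (simp add: power2_norm_eq_inner adj)
    also have "\<dots> \<le> norm (B (?A y)) * norm y"
      by (rule norm_cauchy_schwarz)
    also have "\<dots> \<le> (norm B * norm (?A y)) * norm y"
      by (intro mult_right_mono norm_blinfun) simp
    finally show ?thesis
      by (cases "?A y = 0") (auto simp: power2_eq_square ac_simps)
  qed
  show "bounded_linear ?A"
  proof (rule bounded_linear_intro[where K = "norm B"])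
    show "?A (y + z) = ?A y + ?A z" for y z
      by (rule orthogonal_to_subspace_eq[OF subspace_UNIV])
        (auto simp: inner_simps inner_commute[of "?A _"] adj)
    show "?A (r *\<^sub>R y) = r *\<^sub>R ?A y" for r y
      by (rule orthogonal_to_subspace_eq[OF subspace_UNIV])
        (auto simp: inner_simps inner_commute[of "?A _"] adj)
  qed (use bound in \<open>simp add: mult.commute\<close>)
qed

section \<open>Zeros of strongly monotone maps\<close>

text \<open>A local form of Zarantonello's theorem. For \<open>\<rho> = C / K\<^sup>2\<close> the map \<open>d \<mapsto> d - \<rho> G d\<close> contracts
  the ball with factor \<open>q = sqrt (1 - C\<^sup>2 / K\<^sup>2)\<close>, and it maps the ball into itself as soon as
  \<open>\<rho> \<parallel>G 0\<parallel> \<le> (1 - q) r\<close>. The threshold \<open>\<eta>\<close> is independent of \<open>G\<close>, so that the lemma applies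
  to a whole family of maps at once. The bound on the zero turns smallness of \<open>G 0\<close> into smallness of
  the zero.\<close>

lemma strongly_monotone_has_zero:
  fixes C K r :: real
  assumes "0 < C" "C \<le> K" "0 < r"
  shows "\<exists>\<eta>>0. \<forall>G :: 'a::{real_inner,complete_space} \<Rightarrow> 'a.
    (\<forall>a\<in>cball 0 r. \<forall>b\<in>cball 0 r.
      C * (norm (a - b))\<^sup>2 \<le> (G a - G b) \<bullet> (a - b) \<and> norm (G a - G b) \<le> K * norm (a - b)) \<longrightarrow>
    norm (G 0) \<le> \<eta> \<longrightarrow> (\<exists>d. G d = 0 \<and> C * norm d \<le> norm (G 0))"
proof -
  define \<rho> where "\<rho> = C / K\<^sup>2"
  define q where "q = sqrt (1 - C\<^sup>2 / K\<^sup>2)"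
  have K: "0 < K" using assms by simp
  have \<rho>: "0 < \<rho>" unfolding \<rho>_def using assms K by simp
  have CK: "C\<^sup>2 / K\<^sup>2 \<le> 1" using assms by (simp add: power_mono)
  have q0: "0 \<le> q" unfolding q_def using CK by simp
  have q1: "q < 1" unfolding q_def using assms K by simp
  have q2: "q\<^sup>2 = 1 - C\<^sup>2 / K\<^sup>2" unfolding q_def using CK by simp
  define \<eta> where "\<eta> = (1 - q) * r / \<rho>"
  have "0 < \<eta>" unfolding \<eta>_def using q1 assms \<rho> by simp
  moreover have "\<exists>d. G d = 0 \<and> C * norm d \<le> norm (G 0)"
    if mono: "\<And>a b. a \<in> cball 0 r \<Longrightarrow> b \<in> cball 0 r \<Longrightarrow> C * (norm (a - b))\<^sup>2 \<le> (G a - G b) \<bullet> (a - b)"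
      and lip: "\<And>a b. a \<in> cball 0 r \<Longrightarrow> b \<in> cball 0 r \<Longrightarrow> norm (G a - G b) \<le> K * norm (a - b)"
      and G0: "norm (G 0) \<le> \<eta>" for G :: "'a \<Rightarrow> 'a"
  proof -
    define \<Phi> where "\<Phi> d = d - \<rho> *\<^sub>R G d" for d
    have contr: "norm (\<Phi> a - \<Phi> b) \<le> q * norm (a - b)" if ab: "a \<in> cball 0 r" "b \<in> cball 0 r" for a b
    proof (rule power2_le_imp_le)
      have "(norm (\<Phi> a - \<Phi> b))\<^sup>2
        = (norm (a - b))\<^sup>2 - 2 * \<rho> * ((G a - G b) \<bullet> (a - b)) + \<rho>\<^sup>2 * (norm (G a - G b))\<^sup>2"
        unfolding \<Phi>_def power2_norm_eq_inner
        by (simp add: inner_simps inner_commute algebra_simps power2_eq_square)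
      also have "\<dots> \<le> (norm (a - b))\<^sup>2 - 2 * \<rho> * (C * (norm (a - b))\<^sup>2) + \<rho>\<^sup>2 * (K * norm (a - b))\<^sup>2"
        using mono[OF ab] lip[OF ab] \<rho> by (intro add_mono diff_mono mult_left_mono power_mono) auto
      also have "\<dots> = (q * norm (a - b))\<^sup>2"
        unfolding power_mult_distrib q2 \<rho>_def using K
        by (simp add: field_simps power2_eq_square)
      finally show "(norm (\<Phi> a - \<Phi> b))\<^sup>2 \<le> (q * norm (a - b))\<^sup>2" .
    qed (simp add: q0)
    have self: "\<Phi> ` cball 0 r \<subseteq> cball 0 r"
    proof clarify
      fix d :: 'a assume d: "d \<in> cball 0 r"
      have "norm (\<Phi> d) \<le> norm (\<Phi> d - \<Phi> 0) + norm (\<Phi> 0)"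
        by (metis diff_add_cancel norm_triangle_ineq)
      also have "\<dots> \<le> q * r + \<rho> * \<eta>"
      proof (rule add_mono)
        have "norm (\<Phi> d - \<Phi> 0) \<le> q * norm (d - 0)"
          using d assms(3) by (intro contr) auto
        also have "\<dots> \<le> q * r" using d q0 by (intro mult_left_mono) auto
        finally show "norm (\<Phi> d - \<Phi> 0) \<le> q * r" .
        show "norm (\<Phi> 0) \<le> \<rho> * \<eta>" unfolding \<Phi>_def using G0 \<rho> by simp
      qed
      also have "\<dots> = r" unfolding \<eta>_def using \<rho> by (simp add: field_simps)
      finally show "\<Phi> d \<in> cball 0 r" by simp
    qed
    have "\<exists>!d. d \<in> cball 0 r \<and> \<Phi> d = d"
      using assms(3) q0 q1 self contr
      by (intro Banach_fix[where c = q]) (auto simp: complete_eq_closed dist_norm)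
    then obtain d where d: "d \<in> cball 0 r" "\<Phi> d = d" by blast
    then have Gd: "G d = 0" unfolding \<Phi>_def using \<rho> by simp
    have "C * (norm d)\<^sup>2 \<le> (G d - G 0) \<bullet> d"
      using mono[of d 0] d(1) assms(3) by simp
    also have "\<dots> \<le> norm (G 0) * norm d"
      using norm_cauchy_schwarz[of "- G 0" d] by (simp add: Gd)
    finally have "C * norm d \<le> norm (G 0)"
      by (cases "d = 0") (auto simp: power2_eq_square)
    with Gd show ?thesis by blast
  qed
  ultimately show ?thesis by blast
qed

section \<open>Calculus on subspaces\<close>

lemma at_within_openin:
  assumes "openin (top_of_set T) W" "x \<in> W"
  shows "at x within W = at x within T"
proof -
  obtain U where U: "open U" "W = T \<inter> U"
    using assms(1) by (auto simp: openin_open)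
  show ?thesis
    by (rule at_within_nhd[of x U]) (use assms U in auto)
qed

text \<open>A derivative within a subspace is determined along the subspace only: both candidates give the
  derivative of \<open>f\<close> along the line through \<open>x\<close> in direction \<open>v\<close>.\<close>

lemma has_derivative_unique_on_subspace:
  assumes T: "subspace T" "x \<in> T" "v \<in> T"
    and D: "(f has_derivative D) (at x within T)" "(f has_derivative D') (at x within T)"
  shows "D v = D' v"
proof -
  have line: "((\<lambda>t. x + t *\<^sub>R v) has_derivative (\<lambda>t. t *\<^sub>R v)) (at (0::real))"
    by (auto intro!: derivative_eq_intros)
  have img: "range (\<lambda>t. x + t *\<^sub>R v) \<subseteq> T"
    using T by (auto intro: subspace_add subspace_scale)
  have comp: "((\<lambda>t. f (x + t *\<^sub>R v)) has_derivative (\<lambda>t. E (t *\<^sub>R v))) (at (0::real))"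
    if E: "(f has_derivative E) (at x within T)" for E
  proof (rule has_derivative_in_compose[OF line])
    show "(f has_derivative E) (at (x + 0 *\<^sub>R v) within range (\<lambda>t. x + t *\<^sub>R v))"
      using has_derivative_subset[OF E img] by simp
  qed
  from fun_cong[OF has_derivative_unique[OF comp[OF D(1)] comp[OF D(2)]], of 1]
  show ?thesis by simp
qed

text \<open>Shows that an implicitly chosen \<open>d\<close>, about which only a size estimate is known, is differentiable.\<close>

lemma has_derivative_zero_of_majorant:
  assumes "(h has_derivative (\<lambda>_. 0)) (at a)" "h a = 0" "d a = 0"
    and maj: "\<forall>\<^sub>F t in at a. norm (d t) \<le> K * norm (h t)"
  shows "(d has_derivative (\<lambda>_. 0)) (at a)"
  unfolding has_derivative_within_alt2
proof (intro conjI allI impI)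
  fix e :: real assume e: "0 < e"
  define K' where "K' = max K 1"
  have K': "0 < K'" "K \<le> K'" unfolding K'_def by auto
  have "\<forall>\<^sub>F y in at a. norm (h y) \<le> e / K' * norm (y - a)"
  proof -
    have "\<forall>e>0. \<forall>\<^sub>F y in at a. norm (h y - h a - 0) \<le> e * norm (y - a)"
      using assms(1) unfolding has_derivative_within_alt2 by blast
    then show ?thesis
      using e K'(1) assms(2) by (auto dest: spec[of _ "e / K'"])
  qed
  with maj show "\<forall>\<^sub>F y in at a. norm (d y - d a - 0) \<le> e * norm (y - a)"
  proof eventually_elim
    case (elim y)
    have "norm (d y) \<le> K' * norm (h y)"
      using elim(1) K'(2) by (meson mult_right_mono norm_ge_zero order_trans)
    also have "\<dots> \<le> K' * (e / K' * norm (y - a))"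
      using elim(2) K'(1) by (intro mult_left_mono) auto
    finally show ?case using K'(1) assms(3) by simp
  qed
qed simp

lemma second_order_chain_rule:
  fixes f :: "'a::real_normed_vector \<Rightarrow> 'b::real_normed_vector"
    and g :: "'b \<Rightarrow> 'c::real_normed_vector"
  assumes f: "\<And>x. x \<in> S \<Longrightarrow> (f has_derivative blinfun_apply (f1 x)) (at x within S)"
    and f1: "(f1 has_derivative f2) (at a within S)"
    and g: "\<And>y. y \<in> T \<Longrightarrow> (g has_derivative blinfun_apply (g1 y)) (at y within T)"
    and g1: "(g1 has_derivative g2) (at (f a) within T)"
    and fS: "f ` S \<subseteq> T" and a: "a \<in> S"
  shows "x \<in> S \<Longrightarrow> ((\<lambda>x. g (f x)) has_derivative blinfun_apply (g1 (f x) o\<^sub>L f1 x)) (at x within S)"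
    and "((\<lambda>x. g1 (f x) o\<^sub>L f1 x) has_derivative
          (\<lambda>h. (g1 (f a) o\<^sub>L f2 h) + (g2 (blinfun_apply (f1 a) h) o\<^sub>L f1 a))) (at a within S)"
proof -
  show "((\<lambda>x. g (f x)) has_derivative blinfun_apply (g1 (f x) o\<^sub>L f1 x)) (at x within S)"
    if x: "x \<in> S" for x
  proof -
    have "f x \<in> T" using x fS by auto
    then have "(g has_derivative blinfun_apply (g1 (f x))) (at (f x) within f ` S)"
      using g fS by (blast intro: has_derivative_subset)
    from has_derivative_in_compose[OF f[OF x] this] show ?thesis
      by (simp add: blinfun_compose.rep_eq o_def)
  qed
  have "((\<lambda>x. g1 (f x)) has_derivative (\<lambda>h. g2 (blinfun_apply (f1 a) h))) (at a within S)"
    by (rule has_derivative_in_compose[OF f[OF a] has_derivative_subset[OF g1 fS]])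
  from bounded_bilinear.FDERIV[OF bounded_bilinear_blinfun_compose this f1]
  show "((\<lambda>x. g1 (f x) o\<^sub>L f1 x) has_derivative
          (\<lambda>h. (g1 (f a) o\<^sub>L f2 h) + (g2 (blinfun_apply (f1 a) h) o\<^sub>L f1 a))) (at a within S)" .
qed

text \<open>Apply the mean value inequality to \<open>R - DR 0\<close>, whose derivative \<open>DR u - DR 0\<close> is small in norm
  near \<open>0\<close>. Subtracting the identity instead would fail: \<open>DR 0\<close> is the identity on \<open>T\<close> but arbitrary
  off \<open>T\<close>, so \<open>DR u - id\<close> need not be small in operator norm.\<close>

lemma strictly_differentiable_on_subspace:
  assumes T: "subspace T"
    and R: "\<And>u. u \<in> T \<Longrightarrow> (R has_derivative blinfun_apply (DR u)) (at u within T)"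
    and cont: "continuous (at 0 within T) DR"
    and DR0: "\<And>v. v \<in> T \<Longrightarrow> blinfun_apply (DR 0) v = v"
    and \<epsilon>: "0 < \<epsilon>"
  obtains s where "0 < s"
    "\<And>a b. a \<in> T \<Longrightarrow> b \<in> T \<Longrightarrow> norm a \<le> s \<Longrightarrow> norm b \<le> s \<Longrightarrow>
      norm (R a - R b - (a - b)) \<le> \<epsilon> * norm (a - b)"
proof -
  obtain s' where s': "0 < s'" "\<And>u. u \<in> T \<Longrightarrow> dist u 0 < s' \<Longrightarrow> dist (DR u) (DR 0) < \<epsilon>"
    using cont \<epsilon> unfolding continuous_within_eps_delta by meson
  define s where "s = s' / 2"
  let ?S = "T \<inter> cball 0 s"
  have cvx: "convex ?S"
    using T by (intro convex_Int subspace_imp_convex convex_cball)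
  have "norm (R a - R b - (a - b)) \<le> \<epsilon> * norm (a - b)" if ab: "a \<in> ?S" "b \<in> ?S" for a b
  proof -
    have "norm ((R a - DR 0 a) - (R b - DR 0 b)) \<le> \<epsilon> * norm (a - b)"
    proof (rule differentiable_bound[OF cvx _ _ ab])
      fix u assume u: "u \<in> ?S"
      have "(R has_derivative blinfun_apply (DR u)) (at u within ?S)"
        using R u by (blast intro: has_derivative_subset)
      then show "((\<lambda>u. R u - DR 0 u) has_derivative blinfun_apply (DR u - DR 0)) (at u within ?S)"
        by (auto intro!: derivative_eq_intros simp: blinfun.bilinear_simps)
      show "onorm (blinfun_apply (DR u - DR 0)) \<le> \<epsilon>"
        using s'(2)[of u] u s'(1) unfolding s_def
        by (simp add: norm_blinfun.rep_eq[symmetric] dist_norm)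
    qed
    also have "(R a - DR 0 a) - (R b - DR 0 b) = R a - R b - (a - b)"
      using ab DR0 by simp
    finally show ?thesis .
  qed
  then show thesis
    using that[of s] s'(1) unfolding s_def by simp
qed

section \<open>The tangent space of the constrained set\<close>

lemma curve_in_imp_subset: "curve_in N x v \<gamma> \<Longrightarrow> N \<subseteq> N' \<Longrightarrow> curve_in N' x v \<gamma>"
  unfolding curve_in_def by (auto elim: eventually_mono)

lemma tangent_space_constrained_subset:
  "tangent_space (constrained M B c) x \<subseteq> tangent_space M x \<inter> {v. blinfun_apply B v = 0}"
proof
  fix v assume "v \<in> tangent_space (constrained M B c) x"
  then obtain \<gamma> where \<gamma>: "curve_in (constrained M B c) x v \<gamma>"
    unfolding tangent_space_def by blast
  have "curve_in M x v \<gamma>"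
    using \<gamma> by (rule curve_in_imp_subset) (auto simp: constrained_def)
  moreover have "blinfun_apply B v = 0"
  proof -
    have ev: "\<forall>\<^sub>F t in nhds 0. B (\<gamma> t) = c"
      using \<gamma> unfolding curve_in_def constrained_def by (auto elim: eventually_mono)
    have "((\<lambda>t. B (\<gamma> t)) has_derivative (\<lambda>t. B (t *\<^sub>R v))) (at 0)"
      using \<gamma> unfolding curve_in_def has_vector_derivative_def
      by (auto intro!: derivative_eq_intros)
    moreover have "\<forall>\<^sub>F t in at 0. B (\<gamma> t) = c"
      using ev unfolding eventually_at_filter by (rule eventually_mono) simp
    ultimately have "((\<lambda>t. c) has_derivative (\<lambda>t. B (t *\<^sub>R v))) (at (0::real))"
      by (rule has_derivative_transform_eventually) (use eventually_nhds_x_imp_x[OF ev] in auto)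
    from fun_cong[OF has_derivative_unique[OF this has_derivative_const], of 1] show ?thesis
      by simp
  qed
  ultimately show "v \<in> tangent_space M x \<inter> {v. blinfun_apply B v = 0}"
    unfolding tangent_space_def by blast
qed

text \<open>The curve is \<open>\<gamma> t = R (t v - Q (d t))\<close>, where \<open>d t\<close> is a zero of
  \<open>G d = c - B (R (t v - Q d))\<close>. By strict differentiability \<open>G a - G b\<close> differs from
  \<open>B Q (a - b)\<close> by at most \<open>C / 2 \<parallel>a - b\<parallel>\<close>, so \<open>G\<close> is strongly monotone near \<open>0\<close> with constant
  \<open>C / 2\<close>. The zero satisfies \<open>\<parallel>d t\<parallel> \<le> 2 / C \<parallel>h t\<parallel>\<close> with \<open>h t = B (R (t v)) - c\<close>, and
  \<open>h' 0 = B v = 0\<close>. Hence \<open>d t = o(t)\<close>, and \<open>\<gamma>\<close> has velocity \<open>v\<close>.\<close>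

lemma kernel_subset_tangent_space_constrained:
  fixes B :: "'e::real_inner \<Rightarrow>\<^sub>L 'y::{real_inner,complete_space}"
    and Q :: "'y \<Rightarrow>\<^sub>L 'e"
  assumes T: "subspace T"
    and R: "\<And>u. u \<in> T \<Longrightarrow> (R has_derivative blinfun_apply (DR u)) (at u within T)"
    and cont: "continuous (at 0 within T) DR"
    and DR0: "\<And>v. v \<in> T \<Longrightarrow> blinfun_apply (DR 0) v = v"
    and RM: "\<And>u. u \<in> T \<Longrightarrow> R u \<in> M" and R0: "R 0 = x" and Bx: "B x = c"
    and Q: "\<And>d. Q d \<in> T"
    and C: "0 < C" "\<And>d. C * (norm d)\<^sup>2 \<le> B (Q d) \<bullet> d"
    and v: "v \<in> T" "B v = 0"
  shows "v \<in> tangent_space (constrained M B c) x"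
proof -
  \<comment> \<open>The summand 1, here and in the radius below, avoids division by zero when \<open>B\<close> or \<open>Q\<close> vanishes.\<close>
  define \<epsilon> where "\<epsilon> = C / (2 * (norm B * norm Q + 1))"
  have BQ: "0 \<le> norm B * norm Q" by simp
  have \<epsilon>: "0 < \<epsilon>" unfolding \<epsilon>_def using C(1) BQ by (simp add: add_nonneg_pos)
  have \<epsilon>C: "norm B * \<epsilon> * norm Q \<le> C / 2"
  proof -
    have "norm B * \<epsilon> * norm Q = (norm B * norm Q) * \<epsilon>" by simp
    also have "\<dots> \<le> (norm B * norm Q + 1) * \<epsilon>" using \<epsilon> by (intro mult_right_mono) auto
    also have "\<dots> = C / 2" unfolding \<epsilon>_def using BQ
      by (simp add: add_nonneg_eq_0_iff field_simps)
    finally show ?thesis .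
  qed
  obtain s where s: "0 < s" and strict: "\<And>a b. a \<in> T \<Longrightarrow> b \<in> T \<Longrightarrow> norm a \<le> s \<Longrightarrow> norm b \<le> s \<Longrightarrow>
      norm (R a - R b - (a - b)) \<le> \<epsilon> * norm (a - b)"
    using strictly_differentiable_on_subspace[OF T R cont DR0 \<epsilon>] by blast
  define r where "r = s / (2 * (norm Q + 1))"
  have r: "0 < r" unfolding r_def using s by (simp add: add_nonneg_pos)
  have Qr: "norm (Q d) \<le> s / 2" if "d \<in> cball 0 r" for d
  proof -
    have "norm (Q d) \<le> norm Q * norm d" by (rule norm_blinfun)
    also have "\<dots> \<le> (norm Q + 1) * r" using that by (intro mult_mono) auto
    also have "\<dots> = s / 2" unfolding r_def using norm_ge_zero[of Q]
      by (simp add: add_nonneg_eq_0_iff field_simps)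
    finally show ?thesis .
  qed
  define K where "K = norm B * norm Q + C"
  have CK: "0 < C / 2" "C / 2 \<le> K" using C(1) BQ unfolding K_def by auto
  obtain \<eta> where \<eta>: "0 < \<eta>" and zero: "\<forall>G :: 'y \<Rightarrow> 'y.
      (\<forall>a\<in>cball 0 r. \<forall>b\<in>cball 0 r.
        C / 2 * (norm (a - b))\<^sup>2 \<le> (G a - G b) \<bullet> (a - b) \<and> norm (G a - G b) \<le> K * norm (a - b)) \<longrightarrow>
      norm (G 0) \<le> \<eta> \<longrightarrow> (\<exists>d. G d = 0 \<and> C / 2 * norm d \<le> norm (G 0))"
    using strongly_monotone_has_zero[OF CK r, where ?'a = 'y] by (elim exE conjE)
  define h where "h t = B (R (t *\<^sub>R v)) - c" for t
  have h0: "h 0 = 0" unfolding h_def by (simp add: R0 Bx)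
  have tv: "t *\<^sub>R v \<in> T" for t using T v by (simp add: subspace_scale)
  have dh: "(h has_derivative (\<lambda>_. 0)) (at 0)"
  proof -
    have "(R has_derivative blinfun_apply (DR 0)) (at (0 *\<^sub>R v) within range (\<lambda>t. t *\<^sub>R v))"
      using has_derivative_subset[OF R[OF subspace_0[OF T]]] tv by (auto simp: image_subset_iff)
    then have "((\<lambda>t. R (t *\<^sub>R v)) has_derivative (\<lambda>t. DR 0 (t *\<^sub>R v))) (at (0::real))"
      by (rule has_derivative_in_compose[rotated]) (auto intro!: derivative_eq_intros)
    then have "(h has_derivative (\<lambda>t. B (DR 0 (t *\<^sub>R v)))) (at 0)"
      unfolding h_def by (auto intro!: derivative_eq_intros)
    then show ?thesis by (simp add: DR0[OF v(1)] v(2) blinfun.bilinear_simps)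
  qed
  define sol where "sol t d \<longleftrightarrow> B (R (t *\<^sub>R v - Q d)) = c \<and> C / 2 * norm d \<le> norm (h t)" for t d
  have ev: "\<forall>\<^sub>F t in nhds 0. \<exists>d. sol t d"
  proof -
    have "isCont h 0" using dh has_derivative_continuous by blast
    then have "(h \<longlongrightarrow> h 0) (nhds 0)"
      by (simp add: isCont_def tendsto_at_iff_tendsto_nhds)
    then have "\<forall>\<^sub>F t in nhds 0. dist (h t) (h 0) < \<eta>"
      using \<eta> by (rule tendstoD)
    moreover have "((\<lambda>t. norm (t *\<^sub>R v)) \<longlongrightarrow> norm (0 *\<^sub>R v)) (nhds (0::real))"
      by (intro tendsto_intros) (auto simp: filterlim_ident)
    then have "\<forall>\<^sub>F t in nhds (0::real). norm (t *\<^sub>R v) < s / 2"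
      by (rule order_tendstoD(2)) (simp add: s)
    ultimately show ?thesis
    proof eventually_elim
      case (elim t)
      define G where "G d = c - B (R (t *\<^sub>R v - Q d))" for d
      have inT: "t *\<^sub>R v - Q d \<in> T" for d
        using T tv Q by (simp add: subspace_diff)
      have small: "norm (t *\<^sub>R v - Q d) \<le> s" if "d \<in> cball 0 r" for d
        using Qr[OF that] elim(2) norm_triangle_ineq4[of "t *\<^sub>R v" "Q d"] by linarith
      have approx: "norm (G a - G b - B (Q (a - b))) \<le> C / 2 * norm (a - b)"
        if ab: "a \<in> cball 0 r" "b \<in> cball 0 r" for a b
      proof -
        let ?e = "R (t *\<^sub>R v - Q a) - R (t *\<^sub>R v - Q b) - (t *\<^sub>R v - Q a - (t *\<^sub>R v - Q b))"
        have "norm (G a - G b - B (Q (a - b))) = norm (B ?e)"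
          by (subst norm_minus_cancel[symmetric])
            (simp add: G_def blinfun.bilinear_simps algebra_simps)
        also have "\<dots> \<le> norm B * norm ?e" by (rule norm_blinfun)
        also have "norm ?e \<le> \<epsilon> * norm (t *\<^sub>R v - Q a - (t *\<^sub>R v - Q b))"
          by (rule strict[OF inT inT small[OF ab(1)] small[OF ab(2)]])
        also have "norm (t *\<^sub>R v - Q a - (t *\<^sub>R v - Q b)) = norm (Q (a - b))"
          by (simp add: blinfun.bilinear_simps norm_minus_commute)
        also have "\<dots> \<le> norm Q * norm (a - b)" by (rule norm_blinfun)
        finally have "norm (G a - G b - B (Q (a - b))) \<le> (norm B * \<epsilon> * norm Q) * norm (a - b)"
          using \<epsilon> by (simp add: mult_left_mono mult.assoc)
        also have "\<dots> \<le> C / 2 * norm (a - b)" using \<epsilon>C by (intro mult_right_mono) auto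
        finally show ?thesis .
      qed
      have "\<exists>d. G d = 0 \<and> C / 2 * norm d \<le> norm (G 0)"
      proof (rule zero[rule_format]; (intro conjI)?)
        fix a b :: 'y assume ab: "a \<in> cball 0 r" "b \<in> cball 0 r"
        let ?E = "G a - G b - B (Q (a - b))"
        have "- (?E \<bullet> (a - b)) \<le> norm ?E * norm (a - b)"
          using norm_cauchy_schwarz[of "- ?E" "a - b"] by (metis inner_minus_left norm_minus_cancel)
        also have "\<dots> \<le> C / 2 * norm (a - b) * norm (a - b)"
          by (intro mult_right_mono approx ab) auto
        also have "\<dots> = C / 2 * (norm (a - b))\<^sup>2" by (simp add: power2_eq_square)
        finally have "- (?E \<bullet> (a - b)) \<le> C / 2 * (norm (a - b))\<^sup>2" .
        moreover have "(G a - G b) \<bullet> (a - b) = B (Q (a - b)) \<bullet> (a - b) + ?E \<bullet> (a - b)"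
          by (simp add: inner_diff_left)
        ultimately show "C / 2 * (norm (a - b))\<^sup>2 \<le> (G a - G b) \<bullet> (a - b)"
          using C(2)[of "a - b"] by argo
        have "norm (B (Q (a - b))) \<le> norm B * norm (Q (a - b))" by (rule norm_blinfun)
        also have "\<dots> \<le> norm B * (norm Q * norm (a - b))"
          by (intro mult_left_mono norm_blinfun) simp
        finally have "norm (B (Q (a - b))) \<le> norm B * norm Q * norm (a - b)" by simp
        moreover have "norm (G a - G b) \<le> norm (B (Q (a - b))) + norm ?E"
          by (metis add.commute diff_add_cancel norm_triangle_ineq)
        moreover have "C / 2 * norm (a - b) \<le> C * norm (a - b)"
          using C(1) by (intro mult_right_mono) auto
        ultimately show "norm (G a - G b) \<le> K * norm (a - b)"
          using approx[OF ab] unfolding K_def distrib_right by linarith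
      next
        show "norm (G 0) \<le> \<eta>"
          using elim(1) unfolding h0 by (simp add: G_def h_def norm_minus_commute)
      qed
      then show ?case
        unfolding sol_def G_def h_def blinfun.zero_right diff_0_right right_minus_eq
        by (metis norm_minus_commute)
    qed
  qed
  \<comment> \<open>For \<open>t\<close> away from \<open>0\<close> the value is arbitrary; the range of \<open>Q\<close> keeps \<open>t v - Q (d t)\<close> in \<open>T\<close> anyway.\<close>
  define d where "d t = (SOME d. sol t d)" for t
  have ev': "\<forall>\<^sub>F t in nhds 0. sol t (d t)"
    using ev by eventually_elim (auto simp: d_def intro: someI_ex)
  have d0: "d 0 = 0"
    using eventually_nhds_x_imp_x[OF ev'] C(1) h0 unfolding sol_def by (simp add: mult_le_0_iff)
  have dd: "(d has_derivative (\<lambda>_. 0)) (at 0)"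
  proof (rule has_derivative_zero_of_majorant[where h = h and a = 0 and d = d, OF dh h0 d0])
    have "\<forall>\<^sub>F t in at 0. sol t (d t)"
      using ev' by (auto simp: eventually_at_filter elim: eventually_mono)
    then show "\<forall>\<^sub>F t in at 0. norm (d t) \<le> 2 / C * norm (h t)"
      by eventually_elim (use C(1) in \<open>auto simp: sol_def field_simps\<close>)
  qed
  define \<gamma> where "\<gamma> t = R (t *\<^sub>R v - Q (d t))" for t
  have inT: "t *\<^sub>R v - Q (d t) \<in> T" for t
    using T tv Q by (simp add: subspace_diff)
  have "curve_in (constrained M B c) x v \<gamma>"
    unfolding curve_in_def
  proof (intro conjI)
    show "\<gamma> 0 = x" by (simp add: \<gamma>_def d0 R0)
    show "\<forall>\<^sub>F t in nhds 0. \<gamma> t \<in> constrained M B c"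
      using ev' by eventually_elim (auto simp: \<gamma>_def constrained_def sol_def RM inT)
    have "((\<lambda>t. t *\<^sub>R v - Q (d t)) has_derivative (\<lambda>t. t *\<^sub>R v)) (at 0)"
      using dd by (auto intro!: derivative_eq_intros)
    moreover have "(R has_derivative blinfun_apply (DR 0))
        (at (0 *\<^sub>R v - Q (d 0)) within range (\<lambda>t. t *\<^sub>R v - Q (d t)))"
      using has_derivative_subset[OF R[OF subspace_0[OF T]]] inT d0 by (auto simp: image_subset_iff)
    ultimately have "(\<gamma> has_derivative (\<lambda>t. DR 0 (t *\<^sub>R v))) (at 0)"
      unfolding \<gamma>_def by (rule has_derivative_in_compose)
    then show "(\<gamma> has_vector_derivative v) (at 0)"
      unfolding has_vector_derivative_def by (simp add: DR0 tv)
  qed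
  then show ?thesis unfolding tangent_space_def by blast
qed

section \<open>Gradients and Hessians on closed subspaces\<close>

lemma has_derivative_cong_on_subspace:
  assumes T: "subspace T" "x \<in> T" and f: "(f has_derivative D) (at x within T)"
    and D': "bounded_linear D'" "\<And>v. v \<in> T \<Longrightarrow> D v = D' v"
  shows "(f has_derivative D') (at x within T)"
proof -
  have "D (y - x) = D' (y - x)" if "y \<in> T" for y
    using D'(2) T that by (simp add: subspace_diff)
  with f D'(1) show ?thesis
    unfolding has_derivative_within_alt by simp
qed

lemma grad_on_eq_riesz_rep:
  fixes T :: "'a::{real_inner,complete_space} set"
  assumes T: "subspace T" "closed T" and u: "u \<in> T"
    and D: "(f has_derivative blinfun_apply D) (at u within T)"
  shows "grad_on T f u = riesz_rep T D"
  unfolding grad_on_def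
proof (rule the_equality)
  show "riesz_rep T D \<in> T \<and> (f has_derivative (\<lambda>v. riesz_rep T D \<bullet> v)) (at u within T)"
    by (auto intro!: has_derivative_cong_on_subspace[OF T(1) u D] bounded_linear_inner_right
        simp: riesz_rep_in[OF T] riesz_rep_inner[OF T])
next
  fix g assume "g \<in> T \<and> (f has_derivative (\<lambda>v. g \<bullet> v)) (at u within T)"
  then show "g = riesz_rep T D"
    using has_derivative_unique_on_subspace[OF T(1) u _ D]
    by (intro riesz_rep_unique[OF T, symmetric]) auto
qed

text \<open>The gradient is the image of the derivative under the bounded linear map \<open>riesz_rep T\<close>, so it is
  differentiable when the derivative is, and its derivative is \<open>riesz_rep T \<circ> D2\<close>.\<close>

lemma hess_on_inner_eq:
  fixes T :: "'a::{real_inner,complete_space} set"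
  assumes T: "subspace T" "closed T" and W: "openin (top_of_set T) W" "a \<in> W"
    and D: "\<And>\<xi>. \<xi> \<in> W \<Longrightarrow> (f has_derivative blinfun_apply (D \<xi>)) (at \<xi> within W)"
    and D2: "(D has_derivative D2) (at a within W)"
    and v: "v \<in> T" and u: "u \<in> T"
  shows "hess_on T f a v \<bullet> u = blinfun_apply (D2 v) u"
proof -
  have WT: "W \<subseteq> T" using W(1) by (rule openin_imp_subset)
  have grad: "riesz_rep T (D \<xi>) = grad_on T f \<xi>" if "\<xi> \<in> W" for \<xi>
    using D[OF that] that WT grad_on_eq_riesz_rep[OF T, of \<xi> f "D \<xi>"]
    by (auto simp: at_within_openin[OF W(1) that])
  have "((\<lambda>\<xi>. riesz_rep T (D \<xi>)) has_derivative (\<lambda>h. riesz_rep T (D2 h))) (at a within W)"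
    by (rule bounded_linear.has_derivative[OF bounded_linear_riesz_rep[OF T] D2])
  then have "(grad_on T f has_derivative (\<lambda>h. riesz_rep T (D2 h))) (at a within W)"
    by (rule has_derivative_transform[rotated 2]) (use W grad in auto)
  then have H: "(grad_on T f has_derivative (\<lambda>h. riesz_rep T (D2 h))) (at a within T)"
    by (simp add: at_within_openin[OF W])
  then have "(grad_on T f has_derivative hess_on T f a) (at a within T)"
    unfolding hess_on_def using frechet_derivative_works differentiable_def by blast
  then have "hess_on T f a v = riesz_rep T (D2 v)"
    using has_derivative_unique_on_subspace[OF T(1) _ v _ H] W WT by auto
  then show ?thesis by (simp add: riesz_rep_inner[OF T u])
qed

text \<open>The Riemannian gradient is the orthogonal projection of the ambient gradient. It is unique
  because every tangent vector is the velocity of some curve against which it is tested.\<close>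

lemma norm_riemannian_grad_le:
  fixes N :: "'a::{real_inner,complete_space} set"
  assumes T: "subspace (tangent_space N x)" "closed (tangent_space N x)"
    and f: "(f has_derivative (\<lambda>v. g \<bullet> v)) (at x)"
  shows "norm (riemannian_grad N f x) \<le> norm g"
proof -
  let ?T = "tangent_space N x"
  define p where "p = riesz_rep ?T (blinfun_inner_right g)"
  have p: "p \<in> ?T" "\<And>v. v \<in> ?T \<Longrightarrow> p \<bullet> v = g \<bullet> v"
    unfolding p_def by (auto simp: riesz_rep_in[OF T] riesz_rep_inner[OF T])
  have curve: "((\<lambda>t. f (\<gamma> t)) has_real_derivative g \<bullet> v) (at 0)" if \<gamma>: "curve_in N x v \<gamma>" for v \<gamma>
  proof -
    have "(\<gamma> has_derivative (\<lambda>t. t *\<^sub>R v)) (at 0)" "\<gamma> 0 = x"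
      using \<gamma> by (auto simp: curve_in_def has_vector_derivative_def)
    from has_derivative_compose[OF this(1)] f this(2)
    have "((\<lambda>t. f (\<gamma> t)) has_derivative (\<lambda>t. g \<bullet> (t *\<^sub>R v))) (at 0)" by metis
    then show ?thesis
      by (simp add: has_field_derivative_def mult.commute[of "g \<bullet> v"] mult_commute_abs)
  qed
  have in_T: "v \<in> ?T" if "curve_in N x v \<gamma>" for v \<gamma>
    using that unfolding tangent_space_def by blast
  have "riemannian_grad N f x = p"
    unfolding riemannian_grad_def
  proof (rule the_equality)
    show "p \<in> ?T \<and> (\<forall>v \<gamma>. curve_in N x v \<gamma> \<longrightarrow> ((\<lambda>t. f (\<gamma> t)) has_real_derivative p \<bullet> v) (at 0))"
      using p curve in_T by metis
  next
    fix q assume q: "q \<in> ?T \<and> (\<forall>v \<gamma>. curve_in N x v \<gamma> \<longrightarrow> ((\<lambda>t. f (\<gamma> t)) has_real_derivative q \<bullet> v) (at 0))"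
    show "q = p"
    proof (rule orthogonal_to_subspace_eq[OF T(1)])
      fix v assume v: "v \<in> ?T"
      then obtain \<gamma> where \<gamma>: "curve_in N x v \<gamma>" unfolding tangent_space_def by blast
      then have "q \<bullet> v = g \<bullet> v" using q curve DERIV_unique by blast
      then show "q \<bullet> v = p \<bullet> v" using p v by simp
    qed (use p q in auto)
  qed
  moreover have "norm p \<le> norm g"
  proof -
    have "(norm p)\<^sup>2 = g \<bullet> p" using p by (simp add: power2_norm_eq_inner)
    also have "\<dots> \<le> norm g * norm p" by (rule norm_cauchy_schwarz)
    finally show ?thesis by (cases "p = 0") (auto simp: power2_eq_square)
  qed
  ultimately show ?thesis by simp
qed

section \<open>Second-order behaviour of the implicit retraction\<close>

text \<open>\<open>\<xi> \<mapsto> B (R (\<xi> - Q (\<delta> \<xi>)))\<close> is constant, so its first two derivatives vanish along \<open>TB\<close>. At \<open>0\<close> the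
  first gives \<open>B Q (D\<delta> 0 v) = B v = 0\<close>, hence \<open>D\<delta> 0 v = 0\<close> by coercivity. The second gives
  \<open>B Q z = B (D2R 0 v u)\<close> for \<open>z = D\<^sup>2\<delta> 0 v u\<close>, and pairing with \<open>z\<close> bounds \<open>z\<close> by
  \<open>\<parallel>B\<parallel> K2 / C \<parallel>v\<parallel> \<parallel>u\<parallel>\<close>.\<close>

lemma implicit_retraction_second_order:
  fixes B :: "'e::real_inner \<Rightarrow>\<^sub>L 'y::real_inner" and Q :: "'y \<Rightarrow>\<^sub>L 'e"
  assumes T: "subspace T" and TB: "subspace TB" "\<And>v. v \<in> TB \<Longrightarrow> v \<in> T \<and> B v = 0"
    and W: "openin (top_of_set TB) W" "0 \<in> W"
    and R: "C2_derivs T R DR D2R"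
    and DR0: "\<And>v. v \<in> T \<Longrightarrow> blinfun_apply (DR 0) v = v"
    and K2: "\<And>v w. v \<in> T \<Longrightarrow> w \<in> T \<Longrightarrow>
      norm (blinfun_apply (blinfun_apply (D2R 0) v) w) \<le> K2 * norm v * norm w"
    and Q: "\<And>d. Q d \<in> T"
    and C: "0 < C" "\<And>d. C * (norm d)\<^sup>2 \<le> B (Q d) \<bullet> d"
    and \<delta>: "C2_on W \<delta>" "\<delta> 0 = 0"
    and constraint: "\<And>\<xi>. \<xi> \<in> W \<Longrightarrow> B (R (\<xi> - Q (\<delta> \<xi>))) = c"
  obtains D1 D2 where
    "\<And>\<xi>. \<xi> \<in> W \<Longrightarrow>
      ((\<lambda>\<xi>. R (\<xi> - Q (\<delta> \<xi>))) has_derivative blinfun_apply (D1 \<xi>)) (at \<xi> within W)"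
    "(D1 has_derivative D2) (at 0 within W)"
    "\<And>v. v \<in> TB \<Longrightarrow> D1 0 v = v"
    "\<And>v u. v \<in> TB \<Longrightarrow> u \<in> TB \<Longrightarrow>
      norm (blinfun_apply (D2 v) u) \<le> (K2 + norm Q * (norm B * K2 / C)) * norm v * norm u"
proof -
  obtain \<delta>1 \<delta>2 where "C2_derivs W \<delta> \<delta>1 \<delta>2" using \<delta>(1) unfolding C2_on_def by blast
  then have \<delta>1: "\<And>\<xi>. \<xi> \<in> W \<Longrightarrow> (\<delta> has_derivative blinfun_apply (\<delta>1 \<xi>)) (at \<xi> within W)"
    and \<delta>2: "(\<delta>1 has_derivative blinfun_apply (\<delta>2 0)) (at 0 within W)"
    using W(2) unfolding C2_derivs_def by auto
  have DR: "\<And>u. u \<in> T \<Longrightarrow> (R has_derivative blinfun_apply (DR u)) (at u within T)"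
    and D2R: "(DR has_derivative blinfun_apply (D2R 0)) (at 0 within T)"
    using R subspace_0[OF T] unfolding C2_derivs_def by auto
  have WT: "W \<subseteq> TB" using W(1) by (rule openin_imp_subset)
  define w where "w \<xi> = \<xi> - Q (\<delta> \<xi>)" for \<xi>
  define w1 where "w1 \<xi> = id_blinfun - (Q o\<^sub>L \<delta>1 \<xi>)" for \<xi>
  define w2 where "w2 h = - (Q o\<^sub>L \<delta>2 0 h)" for h
  have w0: "w 0 = 0" by (simp add: w_def \<delta>(2) blinfun.bilinear_simps)
  have w1: "(w has_derivative blinfun_apply (w1 \<xi>)) (at \<xi> within W)" if "\<xi> \<in> W" for \<xi>
    unfolding w_def w1_def
    by (rule has_derivative_eq_rhs, (rule derivative_intros \<delta>1[OF that])+)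
      (auto simp: blinfun.bilinear_simps)
  have w2: "(w1 has_derivative w2) (at 0 within W)"
    unfolding w1_def w2_def
    by (rule has_derivative_eq_rhs,
        (rule derivative_intros \<delta>2 bounded_linear.has_derivative[OF
          bounded_bilinear.bounded_linear_right[OF bounded_bilinear_blinfun_compose]])+) auto
  have wT: "w ` W \<subseteq> T"
    using WT TB(2) T Q by (auto simp: w_def intro!: subspace_diff)
  define D1 where "D1 \<xi> = DR (w \<xi>) o\<^sub>L w1 \<xi>" for \<xi>
  define D2 where "D2 h = (DR (w 0) o\<^sub>L w2 h) + (D2R 0 (w1 0 h) o\<^sub>L w1 0)" for h
  note chain = second_order_chain_rule[where f = w and ?f1.0 = w1 and S = W and g = R and T = T,
      OF w1 w2 DR _ wT W(2), where ?g2.0 = "blinfun_apply (D2R 0)", unfolded w0, OF _ _ D2R]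
  have D1: "((\<lambda>\<xi>. R (w \<xi>)) has_derivative blinfun_apply (D1 \<xi>)) (at \<xi> within W)" if "\<xi> \<in> W" for \<xi>
    unfolding D1_def using chain(1) that by auto
  have D2: "(D1 has_derivative D2) (at 0 within W)"
    unfolding D1_def D2_def w0 using chain(2) by auto
  have BD1: "B (D1 \<xi> v) = 0" if \<xi>: "\<xi> \<in> W" and v: "v \<in> TB" for \<xi> v
  proof -
    have "((\<lambda>\<xi>. B (R (w \<xi>))) has_derivative (\<lambda>v. B (D1 \<xi> v))) (at \<xi> within W)"
      by (rule bounded_linear.has_derivative[OF blinfun.bounded_linear_right D1[OF \<xi>]])
    then have "((\<lambda>\<xi>. c) has_derivative (\<lambda>v. B (D1 \<xi> v))) (at \<xi> within W)"
      by (rule has_derivative_transform[rotated 2]) (use constraint \<xi> in \<open>auto simp: w_def\<close>)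
    then have "((\<lambda>\<xi>. c) has_derivative (\<lambda>v. B (D1 \<xi> v))) (at \<xi> within TB)"
      by (simp add: at_within_openin[OF W(1) \<xi>])
    from has_derivative_unique_on_subspace[OF TB(1) _ v this has_derivative_const] \<xi> WT
    show ?thesis by auto
  qed
  have \<delta>1_zero: "\<delta>1 0 v = 0" if v: "v \<in> TB" for v
  proof -
    have "v - Q (\<delta>1 0 v) \<in> T" using TB(2) v T Q by (auto intro: subspace_diff)
    then have "B (Q (\<delta>1 0 v)) = 0"
      using BD1[OF W(2) v] TB(2)[OF v]
      by (simp add: D1_def w0 w1_def DR0 Q blinfun.bilinear_simps)
    then show ?thesis using C(1) C(2)[of "\<delta>1 0 v"] by (simp add: mult_le_0_iff)
  qed
  have w1_id: "w1 0 v = v" if "v \<in> TB" for v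
    using \<delta>1_zero[OF that] by (simp add: w1_def blinfun.bilinear_simps)
  have D1_id: "D1 0 v = v" if "v \<in> TB" for v
    using TB(2)[OF that] by (simp add: D1_def w0 w1_id[OF that] DR0)
  have "norm (D2 v u) \<le> (K2 + norm Q * (norm B * K2 / C)) * norm v * norm u"
    if v: "v \<in> TB" and u: "u \<in> TB" for v u
  proof -
    define z where "z = \<delta>2 0 v u"
    define y where "y = D2R 0 v u"
    have yK: "norm y \<le> K2 * norm v * norm u" unfolding y_def using K2 TB(2) u v by blast
    have "- Q z \<in> T" using T Q by (simp add: subspace_neg)
    then have D2_eq: "D2 v u = y - Q z"
      unfolding D2_def w0 w2_def by (simp add: blinfun.bilinear_simps w1_id u v y_def z_def DR0 Q)
    have "B (D2 v u) = 0"
    proof -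
      have "((\<lambda>\<xi>. B (D1 \<xi> u)) has_derivative (\<lambda>h. B (D2 h u))) (at 0 within W)"
        by (intro bounded_linear.has_derivative[OF blinfun.bounded_linear_right]
            bounded_linear.has_derivative[OF blinfun.bounded_linear_left] D2)
      then have "((\<lambda>\<xi>. 0) has_derivative (\<lambda>h. B (D2 h u))) (at 0 within W)"
        by (rule has_derivative_transform[rotated 2]) (use BD1 u W(2) in auto)
      then have "((\<lambda>\<xi>. 0) has_derivative (\<lambda>h. B (D2 h u))) (at 0 within TB)"
        by (simp add: at_within_openin[OF W])
      from has_derivative_unique_on_subspace[OF TB(1) _ v this has_derivative_const] W(2) WT
      show ?thesis by auto
    qed
    then have "B (Q z) = B y" by (simp add: D2_eq blinfun.bilinear_simps)
    then have "C * (norm z)\<^sup>2 \<le> B y \<bullet> z" using C(2)[of z] by simp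
    also have "\<dots> \<le> norm (B y) * norm z" by (rule norm_cauchy_schwarz)
    finally have "C * norm z \<le> norm (B y)" by (cases "z = 0") (auto simp: power2_eq_square)
    also have "\<dots> \<le> norm B * norm y" by (rule norm_blinfun)
    also have "\<dots> \<le> norm B * (K2 * norm v * norm u)" using yK by (intro mult_left_mono) auto
    finally have z: "norm z \<le> norm B * (K2 * norm v * norm u) / C"
      using C(1) by (simp add: field_simps)
    have "norm (D2 v u) \<le> norm y + norm (Q z)" unfolding D2_eq by (rule norm_triangle_ineq4)
    also have "\<dots> \<le> K2 * norm v * norm u + norm Q * (norm B * (K2 * norm v * norm u) / C)"
      using yK z norm_blinfun[of Q z] by (meson add_mono mult_left_mono norm_ge_zero order_trans)
    also have "\<dots> = (K2 + norm Q * (norm B * K2 / C)) * norm v * norm u"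
      by (simp add: algebra_simps)
    finally show ?thesis .
  qed
  with D1 D2 D1_id show thesis
    using that[of D1 D2] unfolding w_def by blast
qed

text \<open>The second-order chain rule, simplified by \<open>D1 0\<close> being the identity on \<open>TB\<close>.\<close>

lemma hess_on_comp_inner_eq:
  fixes TB :: "'a::{real_inner,complete_space} set"
    and J :: "'a \<Rightarrow> real"
  assumes TB: "subspace TB" "closed TB" and W: "openin (top_of_set TB) W" "0 \<in> W"
    and D1: "\<And>\<xi>. \<xi> \<in> W \<Longrightarrow> (\<rho> has_derivative blinfun_apply (D1 \<xi>)) (at \<xi> within W)"
    and D2: "(D1 has_derivative D2) (at 0 within W)"
    and D1_id: "\<And>v. v \<in> TB \<Longrightarrow> blinfun_apply (D1 0) v = v"
    and J: "\<And>x. (J has_derivative (\<lambda>v. gradJ x \<bullet> v)) (at x)"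
    and gradJ: "(gradJ has_derivative blinfun_apply H) (at (\<rho> 0))"
    and v: "v \<in> TB" and u: "u \<in> TB"
  shows "hess_on TB (\<lambda>\<xi>. J (\<rho> \<xi>)) 0 v \<bullet> u = gradJ (\<rho> 0) \<bullet> blinfun_apply (D2 v) u + H v \<bullet> u"
proof -
  have J1: "(J has_derivative blinfun_apply (blinfun_inner_right (gradJ y))) (at y within UNIV)" for y
    using J by simp
  have J2: "((\<lambda>y. blinfun_inner_right (gradJ y)) has_derivative (\<lambda>h. blinfun_inner_right (H h)))
      (at (\<rho> 0) within UNIV)"
    by (rule bounded_linear.has_derivative[OF bounded_linear_blinfun_inner_right gradJ])
  note chain = second_order_chain_rule[where f = \<rho> and ?f1.0 = D1 and S = W and g = J and T = UNIV,
      OF D1 D2 J1 J2 subset_UNIV W(2)]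
  show ?thesis
    using hess_on_inner_eq[OF TB W chain(1) chain(2) v u] D1_id v u
    by (simp add: blinfun.bilinear_simps)
qed

section \<open>The uniform bounds\<close>

theorem theorem5p5:
  fixes M X :: "'e::{real_inner,complete_space} set"
    and B :: "'e \<Rightarrow>\<^sub>L 'y::{real_inner,complete_space}"
    and c :: 'y
    and P :: "'e \<Rightarrow> 'e \<Rightarrow>\<^sub>L 'e"
    and R :: "'e \<Rightarrow> 'e \<Rightarrow> 'e"
    and DR :: "'e \<Rightarrow> 'e \<Rightarrow> 'e \<Rightarrow>\<^sub>L 'e"
    and D2R :: "'e \<Rightarrow> 'e \<Rightarrow> 'e \<Rightarrow>\<^sub>L 'e \<Rightarrow>\<^sub>L 'e"
    and l :: "'e \<Rightarrow> 'e \<Rightarrow> 'e \<Rightarrow> 'e"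
    and W :: "'e \<Rightarrow> 'e set"
    and \<delta> :: "'e \<Rightarrow> 'e \<Rightarrow> 'y"
    and J :: "'e \<Rightarrow> real"
    and gradJ :: "'e \<Rightarrow> 'e"
    and HessJ :: "'e \<Rightarrow> 'e \<Rightarrow>\<^sub>L 'e"
  defines "MB \<equiv> constrained M B c"
  assumes M: "C2_submanifold M"
    and B_surj: "surj (blinfun_apply B)"
    and MB_nonempty: "MB \<noteq> {}"
    and P_proj: "\<And>x. x \<in> M \<Longrightarrow> range (blinfun_apply (P x)) = tangent_space M x"
      "\<And>x v. x \<in> M \<Longrightarrow> v \<in> tangent_space M x \<Longrightarrow> blinfun_apply (P x) v = v"
    and R_C2: "\<And>x. x \<in> M \<Longrightarrow> C2_derivs (tangent_space M x) (R x) (DR x) (D2R x)"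
    and R_in: "\<And>x v. x \<in> M \<Longrightarrow> v \<in> tangent_space M x \<Longrightarrow> R x v \<in> M"
    and R_0: "\<And>x. x \<in> M \<Longrightarrow> R x 0 = x"
    and DR_0: "\<And>x v. x \<in> M \<Longrightarrow> v \<in> tangent_space M x \<Longrightarrow> blinfun_apply (DR x 0) v = v"
    and l_bilinear: "\<And>x. x \<in> M \<Longrightarrow> sym_bilinear_on (tangent_space M x) (l x)"
    and l_R: "\<And>x v. x \<in> M \<Longrightarrow> v \<in> tangent_space M x \<Longrightarrow>
      ((\<lambda>\<alpha>. vector_derivative (\<lambda>\<tau>. R x (\<tau> *\<^sub>R v)) (at \<alpha>)) has_vector_derivative l x v v) (at 0)"
    and l_bounded: "\<And>S. bounded S \<Longrightarrow> S \<subseteq> M \<Longrightarrow>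
      \<exists>K. \<forall>x\<in>S. \<forall>v\<in>tangent_space M x. \<forall>w\<in>tangent_space M x. norm (l x v w) \<le> K * norm v * norm w"
    and A1: "\<And>S. bounded S \<Longrightarrow> S \<subseteq> MB \<Longrightarrow>
      \<exists>C>0. \<forall>x\<in>S. \<forall>d. L_op B P x d \<bullet> d \<ge> C * (norm d)\<^sup>2"
    and A2: "continuous_on M P"
      "\<And>S. bounded S \<Longrightarrow> S \<subseteq> M \<Longrightarrow> bounded (P ` S)"
    and A3: "\<And>S. bounded S \<Longrightarrow> S \<subseteq> M \<Longrightarrow>
      \<exists>\<sigma>>0. \<exists>K1>0. \<exists>K2>0. \<forall>x\<in>S. \<forall>u\<in>tangent_space M x. norm u \<le> \<sigma> \<longrightarrow>
        (\<forall>v\<in>tangent_space M x. norm (blinfun_apply (DR x u) v) \<le> K1 * norm v) \<and>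
        (\<forall>v\<in>tangent_space M x. \<forall>w\<in>tangent_space M x.
           norm (blinfun_apply (blinfun_apply (D2R x u) v) w) \<le> K2 * norm v * norm w)"
    and X: "X \<subseteq> MB" "bounded X"
    and W_nhd: "\<And>x. x \<in> X \<Longrightarrow> openin (top_of_set (tangent_space MB x)) (W x) \<and> 0 \<in> W x"
    and \<delta>_C2: "\<And>x. x \<in> X \<Longrightarrow> C2_on (W x) (\<delta> x)"
    and \<delta>_0: "\<And>x. x \<in> X \<Longrightarrow> \<delta> x 0 = 0"
    and \<delta>_constraint: "\<And>x v. x \<in> X \<Longrightarrow> v \<in> W x \<Longrightarrow>
      blinfun_apply B (implicit_retraction B P R \<delta> x v) = c"
    and gradJ: "\<And>x. (J has_derivative (\<lambda>v. gradJ x \<bullet> v)) (at x)"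
    and HessJ: "\<And>x. (gradJ has_derivative blinfun_apply (HessJ x)) (at x)"
    and HessJ_continuous: "continuous_on UNIV HessJ"
    and J_bounded_below: "bdd_below (range J)"
    and J_coercive: "filterlim J at_top at_infinity"
    and gradJ_bounded: "\<And>S. bounded S \<Longrightarrow> bounded (gradJ ` S)"
    and HessJ_bounded: "\<And>S. bounded S \<Longrightarrow> bounded (HessJ ` S)"
  shows "\<exists>\<beta>\<^sub>g>0. \<exists>\<beta>\<^sub>H>0. \<forall>x\<in>X.
      norm (riemannian_grad MB J x) \<le> \<beta>\<^sub>g \<and>
      (\<forall>v\<in>tangent_space MB x. \<forall>u\<in>tangent_space MB x. norm v = 1 \<longrightarrow> norm u = 1 \<longrightarrow>
         \<bar>hess_on (tangent_space MB x) (lifted_objective B P R \<delta> J x) 0 v \<bullet> u\<bar> \<le> \<beta>\<^sub>H)"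
proof -
  define A where "A = Blinfun (adjoint (blinfun_apply B))"
  have A: "A d = adjoint (blinfun_apply B) d" for d
    unfolding A_def by (simp add: bounded_linear_Blinfun_apply bounded_linear_adjoint_blinfun)
  have norm_A: "norm A \<le> norm B"
    by (rule norm_blinfun_bound) (auto simp: A norm_adjoint_blinfun_le)
  have MB_M: "MB \<subseteq> M" unfolding MB_def constrained_def by auto
  have XM: "X \<subseteq> M" using X(1) MB_M by blast
  obtain Kp where Kp: "0 < Kp" "\<And>x. x \<in> X \<Longrightarrow> norm (P x) \<le> Kp"
    using A2(2)[OF X(2) XM] unfolding bounded_pos by auto
  obtain G where G: "0 < G" "\<And>x. x \<in> X \<Longrightarrow> norm (gradJ x) \<le> G"
    using gradJ_bounded[OF X(2)] unfolding bounded_pos by auto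
  obtain H where H: "0 < H" "\<And>x. x \<in> X \<Longrightarrow> norm (HessJ x) \<le> H"
    using HessJ_bounded[OF X(2)] unfolding bounded_pos by auto
  obtain C where C: "0 < C" "\<And>x d. x \<in> X \<Longrightarrow> C * (norm d)\<^sup>2 \<le> L_op B P x d \<bullet> d"
    using A1[OF X(2,1)] by auto
  obtain K2 where K2: "0 < K2" "\<And>x v w. x \<in> X \<Longrightarrow> v \<in> tangent_space M x \<Longrightarrow> w \<in> tangent_space M x \<Longrightarrow>
      norm (blinfun_apply (blinfun_apply (D2R x 0) v) w) \<le> K2 * norm v * norm w"
  proof -
    obtain \<sigma> K1 K2 where "0 < \<sigma>" "0 < K2" and bd: "\<forall>x\<in>X. \<forall>u\<in>tangent_space M x. norm u \<le> \<sigma> \<longrightarrow>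
        (\<forall>v\<in>tangent_space M x. norm (blinfun_apply (DR x u) v) \<le> K1 * norm v) \<and>
        (\<forall>v\<in>tangent_space M x. \<forall>w\<in>tangent_space M x.
           norm (blinfun_apply (blinfun_apply (D2R x u) v) w) \<le> K2 * norm v * norm w)"
      using A3[OF X(2) XM] by blast
    have "0 \<in> tangent_space M x" if "x \<in> X" for x
      using P_proj(1)[of x] XM that by (metis blinfun.zero_right rangeI subsetD)
    then show thesis using that[OF \<open>0 < K2\<close>] bd \<open>0 < \<sigma>\<close> by simp
  qed
  \<comment> \<open>\<open>K2 + Kp \<parallel>B\<parallel> (\<parallel>B\<parallel> K2 / C)\<close> bounds \<open>D\<^sup>2\<rho>(0)\<close> along tangent vectors, where \<open>\<rho>\<close> is the implicit retraction, as \<open>\<parallel>Q\<parallel> \<le> Kp \<parallel>B\<parallel>\<close>.\<close>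
  define \<beta>H where "\<beta>H = G * (K2 + Kp * norm B * (norm B * K2 / C)) + H"
  have "0 < \<beta>H"
    unfolding \<beta>H_def using G(1) K2(1) Kp(1) C(1) H(1)
    by (intro add_nonneg_pos mult_nonneg_nonneg add_nonneg_nonneg divide_nonneg_nonneg) auto
  moreover have "norm (riemannian_grad MB J x) \<le> G \<and>
      (\<forall>v\<in>tangent_space MB x. \<forall>u\<in>tangent_space MB x. norm v = 1 \<longrightarrow> norm u = 1 \<longrightarrow>
         \<bar>hess_on (tangent_space MB x) (lifted_objective B P R \<delta> J x) 0 v \<bullet> u\<bar> \<le> \<beta>H)"
    if x: "x \<in> X" for x
  proof -
    have xM: "x \<in> M" using x XM by blast
    let ?T = "tangent_space M x" and ?TB = "tangent_space MB x"
    define Q where "Q = P x o\<^sub>L A"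
    have Q: "Q d \<in> ?T" for d using P_proj(1)[OF xM] by (auto simp: Q_def)
    have Q_coercive: "C * (norm d)\<^sup>2 \<le> B (Q d) \<bullet> d" for d
      using C(2)[OF x, of d] by (simp add: Q_def L_op_def A)
    have retr: "implicit_retraction B P R \<delta> x = (\<lambda>\<xi>. R x (\<xi> - Q (\<delta> x \<xi>)))"
      by (simp add: fun_eq_iff implicit_retraction_def Q_def A)
    have T: "subspace ?T"
      using linear_subspace_image[OF blinfun.bounded_linear_right[of "P x", THEN bounded_linear.linear] subspace_UNIV] P_proj(1)[OF xM]
      by simp
    \<comment> \<open>As the fixed-point set of a bounded projection, the tangent space of \<open>M\<close> is closed.\<close>
    have T_eq: "?T = {v. P x v = v}"
      using P_proj[OF xM] by (auto simp: set_eq_iff) (metis rangeI)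
    have T_closed: "closed ?T"
      unfolding T_eq by (intro closed_Collect_eq continuous_intros)
    have TB_eq: "?TB = ?T \<inter> {v. B v = 0}"
    proof
      show "?TB \<subseteq> ?T \<inter> {v. B v = 0}"
        unfolding MB_def by (rule tangent_space_constrained_subset)
      show "?T \<inter> {v. B v = 0} \<subseteq> ?TB"
      proof
        fix v assume v: "v \<in> ?T \<inter> {v. B v = 0}"
        have R': "\<And>u. u \<in> ?T \<Longrightarrow> (R x has_derivative blinfun_apply (DR x u)) (at u within ?T)"
          and "(DR x has_derivative blinfun_apply (D2R x 0)) (at 0 within ?T)"
          using R_C2[OF xM] subspace_0[OF T] unfolding C2_derivs_def by auto
        then have "continuous (at 0 within ?T) (DR x)" by (blast dest: has_derivative_continuous)
        moreover have "B x = c" using x X(1) unfolding MB_def constrained_def by auto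
        ultimately show "v \<in> ?TB"
          unfolding MB_def using v
          by (intro kernel_subset_tangent_space_constrained[where Q = Q and C = C and R = "R x" and DR = "DR x",
              OF T R' _ DR_0[OF xM] R_in[OF xM] R_0[OF xM] _ Q C(1) Q_coercive]) auto
      qed
    qed
    have kerB: "subspace {v. B v = 0}" "closed {v. B v = 0}"
      by (auto simp: subspace_def blinfun.bilinear_simps intro!: closed_Collect_eq continuous_intros)
    have TB: "subspace ?TB" "closed ?TB"
      unfolding TB_eq using T T_closed kerB by (auto intro: subspace_inter)
    have grad: "norm (riemannian_grad MB J x) \<le> G"
      using norm_riemannian_grad_le[OF TB gradJ] G(2)[OF x] by linarith
    have W: "openin (top_of_set ?TB) (W x)" "0 \<in> W x" using W_nhd[OF x] by auto
    obtain D1 D2 where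
      D1: "\<And>\<xi>. \<xi> \<in> W x \<Longrightarrow>
        ((\<lambda>\<xi>. R x (\<xi> - Q (\<delta> x \<xi>))) has_derivative blinfun_apply (D1 \<xi>)) (at \<xi> within W x)"
      and D2: "(D1 has_derivative D2) (at 0 within W x)"
      and D1_id: "\<And>v. v \<in> ?TB \<Longrightarrow> D1 0 v = v"
      and D2_bound: "\<And>v u. v \<in> ?TB \<Longrightarrow> u \<in> ?TB \<Longrightarrow>
        norm (blinfun_apply (D2 v) u) \<le> (K2 + norm Q * (norm B * K2 / C)) * norm v * norm u"
    proof (rule implicit_retraction_second_order[OF T TB(1) _ W R_C2[OF xM] _ _
          Q C(1) Q_coercive \<delta>_C2[OF x] \<delta>_0[OF x]])
      show "v \<in> ?T \<and> B v = 0" if "v \<in> ?TB" for v using that TB_eq by auto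
      show "B (R x (\<xi> - Q (\<delta> x \<xi>))) = c" if "\<xi> \<in> W x" for \<xi>
        using \<delta>_constraint[OF x that] by (simp add: retr)
      show "DR x 0 v = v" if "v \<in> ?T" for v using DR_0[OF xM that] .
      show "norm (D2R x 0 v w) \<le> K2 * norm v * norm w" if "v \<in> ?T" "w \<in> ?T" for v w
        using K2(2)[OF x that] .
    qed (use that in blast)
    have base: "R x (0 - Q (\<delta> x 0)) = x"
      by (simp add: \<delta>_0[OF x] R_0[OF xM] blinfun.bilinear_simps)
    have "norm Q \<le> norm (P x) * norm A" unfolding Q_def by (rule norm_blinfun_compose)
    also have "\<dots> \<le> Kp * norm B" using Kp x norm_A by (intro mult_mono) auto
    finally have norm_Q: "norm Q \<le> Kp * norm B" .
    have "\<bar>hess_on ?TB (lifted_objective B P R \<delta> J x) 0 v \<bullet> u\<bar> \<le> \<beta>H"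
      if v: "v \<in> ?TB" and u: "u \<in> ?TB" and nv: "norm v = 1" and nu: "norm u = 1" for v u
    proof -
      have "hess_on ?TB (lifted_objective B P R \<delta> J x) 0 v \<bullet> u = gradJ x \<bullet> D2 v u + HessJ x v \<bullet> u"
        using hess_on_comp_inner_eq[OF TB W D1 D2 D1_id gradJ HessJ v u, unfolded base]
        by (simp add: lifted_objective_def[abs_def] retr)
      moreover have "\<bar>gradJ x \<bullet> D2 v u\<bar> \<le> G * (K2 + Kp * norm B * (norm B * K2 / C))"
      proof -
        have "norm (D2 v u) \<le> K2 + norm Q * (norm B * K2 / C)"
          using D2_bound[OF v u] by (simp add: nv nu)
        also have "\<dots> \<le> K2 + Kp * norm B * (norm B * K2 / C)"
          using norm_Q K2(1) C(1) by (intro add_left_mono mult_right_mono) auto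
        finally have "norm (gradJ x) * norm (D2 v u) \<le> G * (K2 + Kp * norm B * (norm B * K2 / C))"
          using G x by (intro mult_mono) auto
        then show ?thesis using Cauchy_Schwarz_ineq2[of "gradJ x" "D2 v u"] by linarith
      qed
      moreover have "\<bar>HessJ x v \<bullet> u\<bar> \<le> H"
        using Cauchy_Schwarz_ineq2[of "HessJ x v" u] norm_blinfun[of "HessJ x" v] H(2)[OF x]
        by (simp add: nv nu)
      ultimately show ?thesis unfolding \<beta>H_def by linarith
    qed
    with grad show ?thesis by blast
  qed
  ultimately show ?thesis using G(1) by blast
qed

end
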